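(* Suppose that each agent's risk-shaped utility $\tilde U_i(s,\cdot;\lambda)$, where $\tilde U_i(s,a;\lambda)=U_i(s,a)-\lambda\,\mathcal{R}_i(a)$, is continuous in $\lambda$, and that each risk function $\mathcal{R}_i$ is bounded above by some $\bar r_i<\infty$. Then the CAMCO algorithm (described in the context) either finds a feasible joint action or returns $\mathtt{fail}$ within $K_{\max}$ iterations.
   Context: Setting. There are $n$ agents $g_1,\dots,g_n$ and a state space $\mathcal{S}$; $s\in\mathcal{S}$ is the current state. Agent $g_i$ has an action set $\mathcal{A}_i$, a utility function $U_i:\mathcal{S}\times\mathcal{A}_i\to\mathbb{R}_{\ge 0}$ and a risk function $\mathcal{R}_i:\mathcal{A}_i\to\mathbb{R}_{\ge 0}$. The set $\mathcal{F}_i(s)\subseteq\mathcal{A}_i$ consists of the actions available to $g_i$ at $s$ (those satisfying permission, availability and time-window conditions). The joint policy function $\Phi:\mathcal{A}_1\times\cdots\times\mathcal{A}_n\to\{0,1\}$ is a product $\Phi(\mathbf{a})=\prod_{k=1}^K\phi_k(\mathbf{a})$ of policy predicates $\phi_k:\mathcal{A}_1\times\cdots\times\mathcal{A}_n\to\{0,1\}$. The number $\tau>0$ is the aggregate risk threshold, $\delta>0$ a step size, $\lambda_0\ge 0$ an initial multiplier, and $K_{\max}$ the maximum number of iterations. A joint action $\mathbf{a}=(a_1,\dots,a_n)$ is feasible (at $s$) if $\Phi(\mathbf{a})=1$, $\sum_{i=1}^n\mathcal{R}_i(a_i)\le\tau$, and $a_i\in\mathcal{F}_i(s)$ for all $i$.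 Projection. For each agent $i$, $\mathcal{C}_i(s)=\mathcal{F}_i(s)\cap\{a:\phi_k(\cdot)=1\ \forall k\}$, the actions in $\mathcal{F}_i(s)$ that satisfy the policy predicates. The operator $\Pi_{\mathcal{C}}$ sends a proposed action $a\in\mathcal{A}_i$ to a nearest point of $\mathcal{C}_i(s)$ (Euclidean projection for convex continuous action spaces; a constraint-satisfaction search with minimum edit distance for discrete actions); in the algorithm its output may instead be the symbol $\mathtt{reject}$. $\mathrm{SafeDefault}(g_i,s)$ denotes a designated default action of agent $g_i$ at state $s$, used when the projection outputs $\mathtt{reject}$. CAMCO algorithm. Set $\lambda\leftarrow\lambda_0$. For $k=1,\dots,K_{\max}$ do: (1) for every agent $i$, in parallel: set $a_i\leftarrow\arg\max_{a\in\mathcal{A}_i}\tilde U_i(s,a;\lambda)$; set $a_i\leftarrow\Pi_{\mathcal{C}}(a_i)$; if $a_i=\mathtt{reject}$, set $a_i\leftarrow\mathrm{SafeDefault}(g_i,s)$; set $r_i\leftarrow\mathcal{R}_i(a_i)$; (2) set $R_{\mathrm{tot}}\leftarrow\sum_{i=1}^n r_i$; (3) if $\Phi(a_1,\dots,a_n)=1$ and $R_{\mathrm{tot}}\le\tau$, return $\mathbf{a}^*=(a_1,\dots,a_n)$ and stop; otherwise set $\lambda\leftarrow\lambda+\delta\cdot\max(1,R_{\mathrm{tot}}/\tau)$. If the loop ends without returning, return $\mathtt{fail}$.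
   Formalization: The formal statement also assumes that each agent's SafeDefault action is available at the current state (lies in F_i(s)); otherwise an unavailable default could pass the policy and risk test and be returned although it is not feasible. *)

theory Defs
  imports "HOL-Analysis.Analysis"
begin

text \<open>
  Agents are \<open>1, \<dots>, n\<close> and policy predicates are \<open>1, \<dots>, K\<close>. The action sets \<open>A\<^sub>i\<close> are subsets
  of one type \<^typ>\<open>'a\<close>, which loses no generality, since a family of sets embeds in its disjoint
  union.

  The field \<open>completion\<close> is needed because the policy predicates take joint actions, while the
  target set of the projection consists of single actions \<open>a\<close> of agent \<open>i\<close>: the predicate is
  evaluated at a joint action whose \<open>i\<close>-th component is \<open>a\<close>. The other components may depend on
  \<open>i\<close>, on \<open>a\<close> and on the current profile \<open>p\<close> of proposed actions, and are otherwise left open.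
  Taking \<open>completion p i a = p(i := a)\<close> tests \<open>a\<close> against the current proposals of the other agents;
  choosing a violating (or a satisfying) completion whenever there is one yields the reading
  ``the predicates hold for all (or for some) actions of the other agents''.
\<close>

record ('s, 'a) camco =
  num_agents      :: nat
  actions         :: "nat \<Rightarrow> 'a set"
  utility         :: "nat \<Rightarrow> 's \<Rightarrow> 'a \<Rightarrow> real"
  risk            :: "nat \<Rightarrow> 'a \<Rightarrow> real"
  available       :: "nat \<Rightarrow> 's \<Rightarrow> 'a set"
  num_policies    :: nat
  policy          :: "nat \<Rightarrow> (nat \<Rightarrow> 'a) \<Rightarrow> nat"
  threshold       :: real
  step_size       :: real
  init_multiplier :: real
  max_iterations  :: nat
  action_dist     :: "nat \<Rightarrow> 'a \<Rightarrow> 'a \<Rightarrow> real"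
  safe_default    :: "nat \<Rightarrow> 's \<Rightarrow> 'a"
  completion      :: "(nat \<Rightarrow> 'a) \<Rightarrow> nat \<Rightarrow> 'a \<Rightarrow> (nat \<Rightarrow> 'a)"

definition agents :: "('s, 'a) camco \<Rightarrow> nat set" where
  "agents P = {1..num_agents P}"

definition joint_actions :: "('s, 'a) camco \<Rightarrow> (nat \<Rightarrow> 'a) set" where
  "joint_actions P = (\<Pi>\<^sub>E i\<in>agents P. actions P i)"

definition camco_system :: "('s, 'a) camco \<Rightarrow> bool" where
  "camco_system P \<longleftrightarrow>
     (\<forall>i\<in>agents P. \<forall>s. \<forall>a\<in>actions P i. utility P i s a \<ge> 0) \<and>
     (\<forall>i\<in>agents P. \<forall>a\<in>actions P i. risk P i a \<ge> 0) \<and>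
     (\<forall>i\<in>agents P. \<forall>s. available P i s \<subseteq> actions P i) \<and>
     (\<forall>k\<in>{1..num_policies P}. \<forall>a\<in>joint_actions P. policy P k a \<in> {0, 1}) \<and>
     threshold P > 0 \<and> step_size P > 0 \<and> init_multiplier P \<ge> 0 \<and>
     (\<forall>i\<in>agents P. Metric_space (actions P i) (action_dist P i)) \<and>
     (\<forall>i\<in>agents P. \<forall>s. safe_default P i s \<in> actions P i) \<and>
     (\<forall>p\<in>joint_actions P. \<forall>i\<in>agents P. \<forall>a\<in>actions P i.
        completion P p i a \<in> joint_actions P \<and> completion P p i a i = a)"

definition joint_policy :: "('s, 'a) camco \<Rightarrow> (nat \<Rightarrow> 'a) \<Rightarrow> nat" where
  "joint_policy P a = (\<Prod>k=1..num_policies P. policy P k a)"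

definition total_risk :: "('s, 'a) camco \<Rightarrow> (nat \<Rightarrow> 'a) \<Rightarrow> real" where
  "total_risk P a = (\<Sum>i\<in>agents P. risk P i (a i))"

definition feasible :: "('s, 'a) camco \<Rightarrow> 's \<Rightarrow> (nat \<Rightarrow> 'a) \<Rightarrow> bool" where
  "feasible P s a \<longleftrightarrow>
     a \<in> joint_actions P \<and> joint_policy P a = 1 \<and> total_risk P a \<le> threshold P \<and>
     (\<forall>i\<in>agents P. a i \<in> available P i s)"

definition shaped_utility :: "('s, 'a) camco \<Rightarrow> nat \<Rightarrow> 's \<Rightarrow> 'a \<Rightarrow> real \<Rightarrow> real" where
  "shaped_utility P i s a l = utility P i s a - l * risk P i a"

text \<open>
  A maximum need not be attained. In that case the proposal may be any action, so
  that the algorithm never gets stuck; if it is attained, the proposal is a maximiser (ties are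
  broken arbitrarily).
\<close>

definition argmax_choice :: "('a \<Rightarrow> real) \<Rightarrow> 'a set \<Rightarrow> 'a \<Rightarrow> bool" where
  "argmax_choice f A x \<longleftrightarrow>
     x \<in> A \<and> ((\<exists>y. is_arg_max f (\<lambda>z. z \<in> A) y) \<longrightarrow> is_arg_max f (\<lambda>z. z \<in> A) x)"

definition target_set :: "('s, 'a) camco \<Rightarrow> 's \<Rightarrow> (nat \<Rightarrow> 'a) \<Rightarrow> nat \<Rightarrow> 'a set" where
  "target_set P s p i =
     available P i s \<inter> {a. \<forall>k\<in>{1..num_policies P}. policy P k (completion P p i a) = 1}"

text \<open>
  Possible outputs of the projection of agent \<open>i\<close>'s proposal \<open>p i\<close>, with \<^const>\<open>None\<close> for
  \<open>reject\<close>. Rejection is always possible, and is forced if no nearest point exists.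
\<close>

definition projects_to ::
  "('s, 'a) camco \<Rightarrow> 's \<Rightarrow> (nat \<Rightarrow> 'a) \<Rightarrow> nat \<Rightarrow> 'a option \<Rightarrow> bool" where
  "projects_to P s p i out \<longleftrightarrow>
     (case out of
        None \<Rightarrow> True
      | Some c \<Rightarrow> is_arg_min (action_dist P i (p i)) (\<lambda>b. b \<in> target_set P s p i) c)"

text \<open>\<open>round_action P s l a\<close>: with multiplier \<open>l\<close>, the agents' parallel step may produce \<open>a\<close>.\<close>

definition round_action :: "('s, 'a) camco \<Rightarrow> 's \<Rightarrow> real \<Rightarrow> (nat \<Rightarrow> 'a) \<Rightarrow> bool" where
  "round_action P s l a \<longleftrightarrow>
     a \<in> extensional (agents P) \<and>
     (\<exists>p\<in>joint_actions P. \<forall>i\<in>agents P.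
        argmax_choice (\<lambda>b. shaped_utility P i s b l) (actions P i) (p i) \<and>
        (\<exists>out. projects_to P s p i out \<and>
           a i = (case out of None \<Rightarrow> safe_default P i s | Some c \<Rightarrow> c)))"

definition accepted :: "('s, 'a) camco \<Rightarrow> (nat \<Rightarrow> 'a) \<Rightarrow> bool" where
  "accepted P a \<longleftrightarrow> joint_policy P a = 1 \<and> total_risk P a \<le> threshold P"

datatype 'a result = Return "nat \<Rightarrow> 'a" | Fail

text \<open>The natural number counts the iterations of the loop that have been carried out.\<close>

datatype 'a config = Running nat real | Halted nat "'a result"

inductive camco_step :: "('s, 'a) camco \<Rightarrow> 's \<Rightarrow> 'a config \<Rightarrow> 'a config \<Rightarrow> bool"
  for P :: "('s, 'a) camco" and s :: 's where
  accept: "camco_step P s (Running m l) (Halted (Suc m) (Return a))"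
    if "m < max_iterations P" "round_action P s l a" "accepted P a"
| update: "camco_step P s (Running m l)
      (Running (Suc m) (l + step_size P * max 1 (total_risk P a / threshold P)))"
    if "m < max_iterations P" "round_action P s l a" "\<not> accepted P a"
| exhausted: "camco_step P s (Running m l) (Halted m Fail)"
    if "m \<ge> max_iterations P"

definition camco_init :: "('s, 'a) camco \<Rightarrow> 'a config" where
  "camco_init P = Running 0 (init_multiplier P)"

end

theory Submission
  imports Defs
begin

text \<open>Every update consumes one of finitely many iterations, so no run is infinite
  (\<open>camco_step_decreases\<close>, \<open>camco_terminates\<close>). A running configuration
  can always move, because a round can always be carried out (\<open>round_action_exists\<close>,
  \<open>running_progress\<close>); hence a run can only stop in a \<open>Halted\<close>
  configuration. A returned action has passed the test of policy and total risk, and its components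
  are available because each is either a projection into \<open>available\<close> or an available
  safe default (\<open>round_action_accepted_feasible\<close>). The invariant
  \<open>sound_config\<close> carries this and the iteration bound along a run.\<close>

lemma argmax_choice_exists:
  assumes "A \<noteq> {}"
  shows "\<exists>x. argmax_choice f A x"
proof (cases "\<exists>y. is_arg_max f (\<lambda>z. z \<in> A) y")
  case True
  then obtain y where y: "is_arg_max f (\<lambda>z. z \<in> A) y" ..
  then have "y \<in> A" by (simp add: is_arg_max_def)
  with y have "argmax_choice f A y" by (simp add: argmax_choice_def)
  then show ?thesis ..
next
  case False
  obtain x where "x \<in> A" using assms by blast
  with False have "argmax_choice f A x" by (simp add: argmax_choice_def)
  then show ?thesis ..
qed

text \<open>Rejection is a permitted output of every projection, so letting all agents fall back on
  their safe defaults always gives a round, even when no nearest point exists.\<close>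

lemma round_action_exists:
  assumes "\<And>i. i \<in> agents P \<Longrightarrow> actions P i \<noteq> {}"
  shows "\<exists>a. round_action P s l a"
proof -
  have "\<forall>i\<in>agents P. \<exists>x. argmax_choice (\<lambda>b. shaped_utility P i s b l) (actions P i) x"
    using assms by (blast intro: argmax_choice_exists)
  then obtain p where p:
    "\<forall>i\<in>agents P. argmax_choice (\<lambda>b. shaped_utility P i s b l) (actions P i) (p i)"
    by metis
  \<comment> \<open>Joint actions are extensional, so both profiles are made
    \<open>undefined\<close> outside \<open>agents P\<close>.\<close>
  let ?p = "restrict p (agents P)" and ?a = "restrict (\<lambda>i. safe_default P i s) (agents P)"
  have "?p \<in> joint_actions P"
    using p by (auto simp: joint_actions_def argmax_choice_def)
  moreover have "\<forall>i\<in>agents P. projects_to P s ?p i None"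
    by (simp add: projects_to_def)
  ultimately have "round_action P s l ?a"
    unfolding round_action_def using p
    by (intro conjI bexI[of _ ?p] ballI exI[of _ None]) auto
  then show ?thesis by blast
qed

lemma round_action_available:
  assumes "round_action P s l a" "i \<in> agents P" "safe_default P i s \<in> available P i s"
  shows "a i \<in> available P i s"
proof -
  obtain p out where "projects_to P s p i out"
    and "a i = (case out of None \<Rightarrow> safe_default P i s | Some c \<Rightarrow> c)"
    using assms by (auto simp: round_action_def)
  then show ?thesis
    using assms(3)
    by (cases out) (auto simp: projects_to_def is_arg_min_def target_set_def)
qed

text \<open>The acceptance test does not check availability; that part of feasibility comes from how
  the round builds its components.\<close>

lemma round_action_accepted_feasible:
  assumes "round_action P s l a" "accepted P a"
    and "\<And>i. i \<in> agents P \<Longrightarrow> available P i s \<subseteq> actions P i"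
    and "\<And>i. i \<in> agents P \<Longrightarrow> safe_default P i s \<in> available P i s"
  shows "feasible P s a"
proof -
  have "a i \<in> available P i s" if "i \<in> agents P" for i
    using round_action_available[OF assms(1) that assms(4)[OF that]] .
  moreover from this have "a \<in> joint_actions P"
    using assms(1,3) by (auto simp: joint_actions_def round_action_def PiE_def)
  ultimately show ?thesis
    using assms(2) by (simp add: feasible_def accepted_def)
qed

lemma running_progress:
  assumes "\<And>i. i \<in> agents P \<Longrightarrow> actions P i \<noteq> {}"
  shows "\<exists>c. camco_step P s (Running m l) c"
proof -
  obtain a where a: "round_action P s l a"
    using round_action_exists[of P s l] assms by blast
  show ?thesis
  proof (cases "m < max_iterations P")
    case True
    with a show ?thesis
      by (cases "accepted P a") (blast intro: camco_step.accept camco_step.update)+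
  next
    case False
    then have "max_iterations P \<le> m" by simp
    then show ?thesis by (blast intro: camco_step.exhausted)
  qed
qed

text \<open>The \<open>Suc\<close> pays for the halting step, which must still decrease the measure
  once no iterations remain.\<close>

fun steps_left :: "('s, 'a) camco \<Rightarrow> 'a config \<Rightarrow> nat" where
  "steps_left P (Running m l) = Suc (max_iterations P - m)"
| "steps_left P (Halted m r) = 0"

lemma camco_step_decreases: "camco_step P s c c' \<Longrightarrow> steps_left P c' < steps_left P c"
  by (induction rule: camco_step.induct) auto

lemma camco_terminates: "\<nexists>\<rho>. \<forall>t. camco_step P s (\<rho> t) (\<rho> (Suc t))"
proof
  assume "\<exists>\<rho>. \<forall>t. camco_step P s (\<rho> t) (\<rho> (Suc t))"
  then obtain \<rho> where "\<forall>t. (\<rho> (Suc t), \<rho> t) \<in> Wellfounded.measure (steps_left P)"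
    by (auto intro: camco_step_decreases)
  then show False
    using wf_measure[of "steps_left P"] by (auto simp: wf_iff_no_infinite_down_chain)
qed

text \<open>The bound in the \<open>Running\<close> case makes the claim inductive: the
  \<open>exhausted\<close> step passes its counter on unchanged.\<close>

fun sound_config :: "('s, 'a) camco \<Rightarrow> 's \<Rightarrow> 'a config \<Rightarrow> bool" where
  "sound_config P s (Running m l) \<longleftrightarrow> m \<le> max_iterations P"
| "sound_config P s (Halted m (Return a)) \<longleftrightarrow> m \<le> max_iterations P \<and> feasible P s a"
| "sound_config P s (Halted m Fail) \<longleftrightarrow> m \<le> max_iterations P"

lemma reachable_sound:
  assumes "(camco_step P s)\<^sup>*\<^sup>* (camco_init P) c"
    and "\<And>i. i \<in> agents P \<Longrightarrow> available P i s \<subseteq> actions P i"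
    and "\<And>i. i \<in> agents P \<Longrightarrow> safe_default P i s \<in> available P i s"
  shows "sound_config P s c"
  using assms(1)
proof (induction rule: rtranclp_induct)
  case base
  show ?case by (simp add: camco_init_def)
next
  case (step c c')
  from step.hyps(2) step.IH show ?case
    by cases (auto dest: round_action_accepted_feasible[OF _ _ assms(2,3)])
qed

theorem theorem1:
  fixes P :: "('s, 'a) camco" and s :: 's and rbar :: "nat \<Rightarrow> real"
  assumes system: "camco_system P"
    and safe: "\<And>i. i \<in> agents P \<Longrightarrow> safe_default P i s \<in> available P i s"
    and continuity: "\<And>i a. i \<in> agents P \<Longrightarrow> a \<in> actions P i \<Longrightarrow>
      continuous_on {0..} (\<lambda>l. shaped_utility P i s a l)"
    and bounded_risk: "\<And>i a. i \<in> agents P \<Longrightarrow> a \<in> actions P i \<Longrightarrow> risk P i a \<le> rbar i"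
  shows "(\<nexists>\<rho>. \<rho> 0 = camco_init P \<and> (\<forall>t. camco_step P s (\<rho> t) (\<rho> (Suc t)))) \<and>
    (\<forall>c. (camco_step P s)\<^sup>*\<^sup>* (camco_init P) c \<and> (\<nexists>c'. camco_step P s c c') \<longrightarrow>
      (\<exists>m\<le>max_iterations P.
         (\<exists>a. c = Halted m (Return a) \<and> feasible P s a) \<or> c = Halted m Fail))"
proof (intro conjI allI impI)
  show "\<nexists>\<rho>. \<rho> 0 = camco_init P \<and> (\<forall>t. camco_step P s (\<rho> t) (\<rho> (Suc t)))"
    using camco_terminates[of P s] by blast
next
  fix c
  assume c: "(camco_step P s)\<^sup>*\<^sup>* (camco_init P) c \<and> (\<nexists>c'. camco_step P s c c')"
  have avail: "available P i s \<subseteq> actions P i" if "i \<in> agents P" for i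
    using system that by (simp add: camco_system_def)
  \<comment> \<open>The safe default is a witness.\<close>
  have nonempty: "actions P i \<noteq> {}" if "i \<in> agents P" for i
    using avail safe that by blast
  have "sound_config P s c"
    by (rule reachable_sound[OF conjunct1[OF c] avail safe])
  \<comment> \<open>A \<open>Running\<close> configuration would have a successor, but
    \<open>c\<close> has none.\<close>
  moreover obtain m r where "c = Halted m r"
    using c running_progress[of P s] nonempty by (cases c) auto
  ultimately show "\<exists>m\<le>max_iterations P.
      (\<exists>a. c = Halted m (Return a) \<and> feasible P s a) \<or> c = Halted m Fail"
    by (cases r) auto
qed

end
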